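(* Let $G$ be an edge-colored graph of order $n$ and let $k$ be a positive integer with $k\geq 5$. If $G$ has no rainbow cycle of length $4$ and $\delta^c(G)>\frac{n+3k-3}{2}$, then $G$ contains a rainbow cycle of length at least $k$.
   Context: All graphs are finite, simple and undirected. An edge-colored graph is a graph $G$ together with an arbitrary mapping $c:E(G)\to\mathbb{N}$ (not required to be a proper coloring). The order of $G$ is $|V(G)|$. The color-degree $d^c_G(v)$ of a vertex $v$ is the number of distinct colors on the edges incident to $v$, and $\delta^c(G)=\min\{d^c_G(v):v\in V(G)\}$ is the minimum color-degree of $G$. A subgraph of $G$ is rainbow if its edges have pairwise distinct colors. The length of a cycle is its number of edges. *)

theory Defs
  imports Complex_Main
begin

locale simple_graph =
  fixes V :: "'a set" and E :: "'a set set"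
  assumes finite_V: "finite V"
    and nonempty_V: "V \<noteq> {}"
    and edges: "e \<in> E \<Longrightarrow> \<exists>u\<in>V. \<exists>v\<in>V. u \<noteq> v \<and> e = {u, v}"

text \<open>An edge-coloring is a function on all vertex sets; only its values on the edge set matter.\<close>

definition color_degree :: "'a set set \<Rightarrow> ('a set \<Rightarrow> nat) \<Rightarrow> 'a \<Rightarrow> nat" where
  "color_degree E c v = card (c ` {e \<in> E. v \<in> e})"

text \<open>\<^const>\<open>Min\<close> is unspecified on the empty set, so this is meaningful only if the
  vertex set is nonempty, as it is in \<^locale>\<open>simple_graph\<close>.\<close>

definition min_color_degree :: "'a set \<Rightarrow> 'a set set \<Rightarrow> ('a set \<Rightarrow> nat) \<Rightarrow> nat" where
  "min_color_degree V E c = Min (color_degree E c ` V)"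

definition closed_walk_edges :: "'a list \<Rightarrow> 'a set set" where
  "closed_walk_edges vs = {{vs ! i, vs ! (Suc i mod length vs)} | i. i < length vs}"

text \<open>A cycle has no isolated vertices, so as a subgraph it is determined by its edge set
  \<open>C\<close>; its length is \<open>card C\<close>.\<close>

definition is_cycle :: "'a set set \<Rightarrow> 'a set set \<Rightarrow> bool" where
  "is_cycle E C \<longleftrightarrow>
    C \<subseteq> E \<and> (\<exists>vs. length vs \<ge> 3 \<and> distinct vs \<and> C = closed_walk_edges vs)"

definition rainbow :: "('a set \<Rightarrow> nat) \<Rightarrow> 'a set set \<Rightarrow> bool" where
  "rainbow c F \<longleftrightarrow> inj_on c F"

lemma card_closed_walk_edges:
  assumes "distinct vs" "length vs \<ge> 3"
  shows "card (closed_walk_edges vs) = length vs"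
proof -
  let ?n = "length vs"
  let ?f = "\<lambda>i. {vs ! i, vs ! (Suc i mod ?n)}"
  have "inj_on ?f {..<?n}"
  proof (rule inj_onI)
    fix i j assume ij: "i \<in> {..<?n}" "j \<in> {..<?n}" and eq: "?f i = ?f j"
    have lt: "Suc i mod ?n < ?n" "Suc j mod ?n < ?n"
      using assms(2) by (auto intro!: mod_less_divisor)
    have "i = j \<or> (i = Suc j mod ?n \<and> Suc i mod ?n = j)"
      using eq ij lt assms(1) by (auto simp: doubleton_eq_iff nth_eq_iff_index_eq)
    then show "i = j"
      using ij assms(2) by (auto simp: mod_Suc split: if_splits)
  qed
  moreover have "closed_walk_edges vs = ?f ` {..<?n}"
    unfolding closed_walk_edges_def by auto
  ultimately show ?thesis by (simp add: card_image)
qed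

end

theory Submission
  imports Defs
begin

text \<open>
  The two assumptions contradict each other: an edge-colored graph of order \<open>n\<close> without a
  rainbow cycle of length 4 has minimum color-degree \<open>d\<close> at most \<open>(n + 3) / 2\<close>, which is less
  than \<open>(n + 3k - 3) / 2\<close>. So the theorem reduces to this bound, which is
  \<open>min_color_degree_le_if_no_rainbow_C4\<close>.

  The bound is a double count. Let every vertex \<open>u\<close> keep a set \<open>N u\<close> of \<open>d\<close> neighbors joined to
  it by edges of \<open>d\<close> distinct colors, and count the triples \<open>(u, v, w)\<close> with \<open>u \<noteq> v\<close> and
  \<open>w \<in> N u \<inter> N v\<close>.

  \<^item> Each \<open>w\<close> lies in \<open>d\<close> of the sets \<open>N u\<close> on average, so by convexity there are at least
    \<open>n d (d - 1)\<close> triples.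
  \<^item> For fixed \<open>u \<noteq> v\<close>, call \<open>w\<close> two-colored if the edges \<open>uw\<close> and \<open>vw\<close> have different colors.
    If \<open>w\<close> and \<open>x\<close> are both two-colored, then the 4-cycle \<open>u w v x\<close> fails to be rainbow only
    because one of its two pairs of opposite edges has a single color. Such coincidences are
    rare enough to leave at most three two-colored \<open>w\<close> (\<open>card_common_two_colored_le_3\<close>).
  \<^item> The other triples are paths \<open>u w v\<close> with both edges of the same color. The at most \<open>n - 1\<close>
    edges at \<open>w\<close> show at least \<open>d\<close> colors, so few pairs of them agree in color: at most
    \<open>(n - d) (n - d - 1)\<close> ordered pairs (\<open>card_monochromatic_pairs_le\<close>).

  Hence \<open>n d (d - 1) \<le> 3 n (n - 1) + n (n - d) (n - d - 1)\<close>, and this inequality rearranges to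
  \<open>0 \<le> n (n - 1) (n + 3 - 2 d)\<close>.
\<close>

definition neighbours :: "'a set set \<Rightarrow> 'a \<Rightarrow> 'a set" where
  "neighbours E v = {w. {v, w} \<in> E}"

lemma (in simple_graph) edge_ends:
  assumes "{u, v} \<in> E"
  shows "u \<in> V" "v \<in> V" "u \<noteq> v"
  using edges[OF assms] by (auto simp: doubleton_eq_iff)

lemma (in simple_graph) neighbours_subset: "neighbours E v \<subseteq> V - {v}"
proof
  fix w assume "w \<in> neighbours E v"
  then have "{v, w} \<in> E" by (simp add: neighbours_def)
  then show "w \<in> V - {v}" using edge_ends(2,3) by blast
qed

lemma (in simple_graph) finite_neighbours: "finite (neighbours E v)"
  using neighbours_subset finite_V finite_subset by blast

lemma (in simple_graph) color_degree_neighbours: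
  "color_degree E c v = card ((\<lambda>w. c {v, w}) ` neighbours E v)"
proof -
  have "{e \<in> E. v \<in> e} = (\<lambda>w. {v, w}) ` neighbours E v"
  proof (intro equalityI subsetI)
    fix e assume "e \<in> {e \<in> E. v \<in> e}"
    then have e: "e \<in> E" "v \<in> e" by auto
    from edges[OF e(1)] obtain x y where "e = {x, y}" by blast
    with e(2) obtain w where "e = {v, w}" by blast
    with e(1) show "e \<in> (\<lambda>w. {v, w}) ` neighbours E v"
      by (auto simp: neighbours_def)
  qed (auto simp: neighbours_def)
  then show ?thesis
    by (simp add: color_degree_def image_image)
qed

lemma is_cycle_quadrilateral:
  assumes "distinct [u, w, v, x]"
    and "{u, w} \<in> E" "{w, v} \<in> E" "{v, x} \<in> E" "{x, u} \<in> E"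
  shows "is_cycle E {{u, w}, {w, v}, {v, x}, {x, u}}"
proof -
  let ?vs = "[u, w, v, x]"
  have len: "{..<length ?vs} = {0, Suc 0, Suc (Suc 0), Suc (Suc (Suc 0))}"
    by (simp add: lessThan_Suc insert_commute)
  have "closed_walk_edges ?vs = (\<lambda>i. {?vs ! i, ?vs ! (Suc i mod length ?vs)}) ` {..<length ?vs}"
    unfolding closed_walk_edges_def by blast
  also have "\<dots> = {{u, w}, {w, v}, {v, x}, {x, u}}"
    unfolding len by simp
  finally have "{{u, w}, {w, v}, {v, x}, {x, u}} = closed_walk_edges ?vs" ..
  moreover have "3 \<le> length ?vs" by simp
  ultimately show ?thesis
    unfolding is_cycle_def using assms by blast
qed

lemma card_off_diagonal:
  assumes "finite A"
  shows "card {p \<in> A \<times> A. fst p \<noteq> snd p} = card A * (card A - 1)"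
proof -
  have "{p \<in> A \<times> A. fst p \<noteq> snd p} = (SIGMA u:A. A - {u})" by auto
  then show ?thesis using assms by simp
qed

text \<open>If the fibers of \<open>f\<close> have sizes \<open>s y\<close>, there are \<open>\<Sum>y. s y * (s y - 1)\<close> ordered pairs. The
  excesses \<open>s y - 1\<close> add up to \<open>D = card A - card (f ` A)\<close>, so each fiber has at most \<open>D + 1\<close>
  elements. The bound is attained when one fiber carries the whole excess.\<close>

lemma card_monochromatic_pairs_le:
  assumes "finite A"
  shows "card {p \<in> A \<times> A. fst p \<noteq> snd p \<and> f (fst p) = f (snd p)}
    \<le> Suc (card A - card (f ` A)) * (card A - card (f ` A))"
proof -
  define s where "s y = card {u \<in> A. f u = y}" for y
  have s_pos: "s y \<ge> 1" if "y \<in> f ` A" for y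
    using that assms by (auto simp: s_def Suc_le_eq card_gt_0_iff)
  have sum_s: "card A = (\<Sum>y\<in>f ` A. s y)"
    using sum.image_gen[OF assms, of "\<lambda>_. 1::nat" f] by (simp add: s_def)
  have excess: "(\<Sum>y\<in>f ` A. s y - 1) = card A - card (f ` A)"
    using s_pos by (simp add: sum_s sum_subtractf_nat)
  have s_le: "s y \<le> Suc (card A - card (f ` A))" if "y \<in> f ` A" for y
    using member_le_sum[OF that, of "\<lambda>y. s y - 1"] assms excess by simp
  have "{p \<in> A \<times> A. fst p \<noteq> snd p \<and> f (fst p) = f (snd p)}
      = (SIGMA u:A. {v \<in> A. f v = f u} - {u})" by auto
  then have "card {p \<in> A \<times> A. fst p \<noteq> snd p \<and> f (fst p) = f (snd p)}
      = (\<Sum>u\<in>A. s (f u) - 1)"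
    using assms by (simp add: card_SigmaI s_def)
  also have "\<dots> = (\<Sum>y\<in>f ` A. s y * (s y - 1))"
    by (subst sum.image_gen[OF assms, of _ f]) (simp add: s_def)
  also have "\<dots> \<le> (\<Sum>y\<in>f ` A. Suc (card A - card (f ` A)) * (s y - 1))"
    by (intro sum_mono mult_le_mono1 s_le)
  also have "\<dots> = Suc (card A - card (f ` A)) * (card A - card (f ` A))"
    by (simp only: sum_distrib_left[symmetric] excess)
  finally show ?thesis .
qed

text \<open>Draw an arc from \<open>w\<close> to \<open>x\<close> when \<open>f w = g x\<close>. As \<open>g\<close> is injective, there are at most
  \<open>card M\<close> arcs, but each of the \<open>card M * (card M - 1) / 2\<close> unordered pairs must carry one.\<close>

lemma card_le_3_if_pairs_matched:
  assumes "finite M" "inj_on f M" "inj_on g M"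
    and matched: "\<And>w x. w \<in> M \<Longrightarrow> x \<in> M \<Longrightarrow> w \<noteq> x \<Longrightarrow> f w = g x \<or> g w = f x"
  shows "card M \<le> 3"
proof -
  define A where "A = {p \<in> M \<times> M. f (fst p) = g (snd p)}"
  have finA: "finite A" unfolding A_def using assms(1) by simp
  have "inj_on fst A"
    using assms(3) by (auto simp: A_def inj_on_def)
  moreover have "fst ` A \<subseteq> M" by (auto simp: A_def)
  ultimately have cA: "card A \<le> card M"
    using assms(1) card_inj_on_le by blast
  have "{p \<in> M \<times> M. fst p \<noteq> snd p} \<subseteq> A \<union> prod.swap ` A"
  proof
    fix p assume "p \<in> {p \<in> M \<times> M. fst p \<noteq> snd p}"
    then obtain w x where p: "p = (w, x)" "w \<in> M" "x \<in> M" "w \<noteq> x" by auto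
    then have "(w, x) \<in> A \<or> (x, w) \<in> A" using matched[of w x] by (auto simp: A_def)
    then show "p \<in> A \<union> prod.swap ` A" using p by force
  qed
  then have "card {p \<in> M \<times> M. fst p \<noteq> snd p} \<le> card (A \<union> prod.swap ` A)"
    using finA by (intro card_mono) auto
  also have "\<dots> \<le> card A + card (prod.swap ` A)" by (rule card_Un_le)
  also have "\<dots> \<le> card M + card M"
    using cA card_image_le[OF finA, of prod.swap] by linarith
  finally have "card M * (card M - 1) \<le> card M * 2"
    by (simp only: card_off_diagonal[OF assms(1)] mult_2_right)
  then have "card M = 0 \<or> card M - 1 \<le> 2"
    by (simp only: mult_le_cancel1) linarith
  then show ?thesis by linarith
qed

text \<open>In the 4-cycle \<open>u w v x\<close> any two adjacent edges have different colors: those meeting at \<open>u\<close>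
  or \<open>v\<close> by injectivity, those meeting at \<open>w\<close> or \<open>x\<close> because these vertices are two-colored.
  So only opposite edges can agree in color, and one of the two opposite pairs must do so.\<close>

lemma (in simple_graph) card_common_two_colored_le_3:
  assumes no_C4: "\<not> (\<exists>C. is_cycle E C \<and> rainbow c C \<and> card C = 4)"
    and "u \<noteq> v" "M \<subseteq> neighbours E u" "M \<subseteq> neighbours E v"
    and inj_u: "inj_on (\<lambda>w. c {u, w}) M" and inj_v: "inj_on (\<lambda>w. c {v, w}) M"
    and two_colored: "\<And>w. w \<in> M \<Longrightarrow> c {u, w} \<noteq> c {v, w}"
  shows "card M \<le> 3"
proof (rule card_le_3_if_pairs_matched[OF _ inj_u inj_v])
  show "finite M" using assms(3) finite_neighbours finite_subset by blast
next
  fix w x assume wx: "w \<in> M" "x \<in> M" "w \<noteq> x"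
  let ?C = "{{u, w}, {w, v}, {v, x}, {x, u}}"
  have edges_C: "{u, w} \<in> E" "{v, w} \<in> E" "{u, x} \<in> E" "{v, x} \<in> E"
    using wx assms(3,4) by (auto simp: neighbours_def)
  have dist: "distinct [u, w, v, x]"
    using edges_C[THEN edge_ends(3)] wx \<open>u \<noteq> v\<close> by auto
  have cyc: "is_cycle E ?C"
    by (rule is_cycle_quadrilateral[OF dist]) (use edges_C in \<open>simp_all add: insert_commute\<close>)
  have four: "card ?C = 4"
    using dist by (simp add: card_insert_if doubleton_eq_iff) auto
  show "c {u, w} = c {v, x} \<or> c {v, w} = c {u, x}"
  proof (rule ccontr)
    assume "\<not> ?thesis"
    moreover have "c {u, w} \<noteq> c {u, x}" "c {v, w} \<noteq> c {v, x}"
      using wx inj_onD[OF inj_u, of w x] inj_onD[OF inj_v, of w x] by auto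
    ultimately have "rainbow c ?C"
      using two_colored[OF wx(1)] two_colored[OF wx(2)]
      unfolding rainbow_def by (simp add: inj_on_def insert_commute)
    with no_C4 cyc four show False by blast
  qed
qed

theorem (in simple_graph) min_color_degree_le_if_no_rainbow_C4:
  assumes no_C4: "\<not> (\<exists>C. is_cycle E C \<and> rainbow c C \<and> card C = 4)"
    and deg: "\<And>v. v \<in> V \<Longrightarrow> d \<le> color_degree E c v"
  shows "2 * d \<le> card V + 3"
proof -
  define n where "n = card V"
  have n_pos: "n \<ge> 1"
    using finite_V nonempty_V by (simp add: n_def Suc_le_eq card_gt_0_iff)
  have card_nbrs: "card (neighbours E v) \<le> n - 1" if "v \<in> V" for v
    using card_mono[OF _ neighbours_subset[of v]] finite_V that by (simp add: n_def)
  have d_le: "d \<le> n - 1"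
  proof -
    obtain v where v: "v \<in> V" using nonempty_V by auto
    show ?thesis
      using deg[OF v] card_nbrs[OF v] card_image_le[OF finite_neighbours[of v], of "\<lambda>w. c {v, w}"]
      unfolding color_degree_neighbours by linarith
  qed
  have "\<forall>u\<in>V. \<exists>N. N \<subseteq> neighbours E u \<and> inj_on (\<lambda>w. c {u, w}) N \<and> card N = d"
  proof
    fix u assume u: "u \<in> V"
    obtain K where K: "K \<subseteq> (\<lambda>w. c {u, w}) ` neighbours E u" "card K = d" "finite K"
      by (rule obtain_subset_with_card_n[OF deg[OF u, unfolded color_degree_neighbours]])
    from K(1) obtain N where N: "N \<subseteq> neighbours E u" "inj_on (\<lambda>w. c {u, w}) N"
        "K = (\<lambda>w. c {u, w}) ` N"
      unfolding subset_image_inj by blast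
    then have "card N = d" using K(2) card_image by metis
    with N show "\<exists>N. N \<subseteq> neighbours E u \<and> inj_on (\<lambda>w. c {u, w}) N \<and> card N = d"
      by blast
  qed
  from bchoice[OF this] obtain N where N_all:
    "\<forall>u\<in>V. N u \<subseteq> neighbours E u \<and> inj_on (\<lambda>w. c {u, w}) (N u) \<and> card (N u) = d" ..
  have N: "N u \<subseteq> neighbours E u" "inj_on (\<lambda>w. c {u, w}) (N u)" "card (N u) = d"
    if "u \<in> V" for u
    using N_all that by simp_all
  define P where "P = {p \<in> V \<times> V. fst p \<noteq> snd p}"
  have finP: "finite P" using finite_V by (simp add: P_def)
  have cardP: "card P = n * (n - 1)"
    unfolding P_def n_def by (rule card_off_diagonal[OF finite_V])
  define b where "b w = card {u \<in> V. w \<in> N u}" for w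
  let ?common = "\<lambda>p w. w \<in> N (fst p) \<and> w \<in> N (snd p)"
  let ?mono = "\<lambda>p w. w \<in> neighbours E (fst p) \<and> w \<in> neighbours E (snd p)
    \<and> c {fst p, w} = c {snd p, w}"

  have sum_b: "(\<Sum>w\<in>V. b w) = n * d"
  proof -
    have "(\<Sum>u\<in>V. card {w \<in> V. w \<in> N u}) = (\<Sum>w\<in>V. b w)"
      by (rule sum_multicount_gen) (auto simp: finite_V b_def)
    moreover have "{w \<in> V. w \<in> N u} = N u" if "u \<in> V" for u
      using N(1)[OF that] neighbours_subset[of u] by auto
    ultimately show ?thesis using N(3) by (simp add: n_def)
  qed
  \<comment> \<open>Both kinds of triples are regrouped by the middle vertex \<open>w\<close>, where they become pairs of
    distinct vertices.\<close>
  have common_by_middle: "(\<Sum>p\<in>P. card {w \<in> V. ?common p w}) = (\<Sum>w\<in>V. b w * (b w - 1))"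
  proof (rule sum_multicount_gen[OF finP finite_V], rule ballI)
    fix w
    have "{p \<in> P. ?common p w}
        = {p \<in> {u \<in> V. w \<in> N u} \<times> {u \<in> V. w \<in> N u}. fst p \<noteq> snd p}"
      by (auto simp: P_def)
    then show "card {p \<in> P. ?common p w} = b w * (b w - 1)"
      using card_off_diagonal[of "{u \<in> V. w \<in> N u}"] finite_V by (simp add: b_def)
  qed
  have mono_by_middle: "(\<Sum>p\<in>P. card {w \<in> V. ?mono p w}) \<le> n * ((n - d) * (n - d - 1))"
  proof -
    have "(\<Sum>p\<in>P. card {w \<in> V. ?mono p w}) = (\<Sum>w\<in>V. card {p \<in> P. ?mono p w})"
      by (rule sum_multicount_gen) (auto simp: finP finite_V)
    also have "\<dots> \<le> (\<Sum>w\<in>V. (n - d) * (n - d - 1))"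
    proof (rule sum_mono)
      fix w assume w: "w \<in> V"
      let ?A = "neighbours E w" and ?f = "\<lambda>u. c {w, u}"
      have "{p \<in> P. ?mono p w} = {p \<in> ?A \<times> ?A. fst p \<noteq> snd p \<and> ?f (fst p) = ?f (snd p)}"
        using neighbours_subset[of w] by (auto simp: P_def neighbours_def insert_commute)
      then have "card {p \<in> P. ?mono p w}
          \<le> Suc (card ?A - card (?f ` ?A)) * (card ?A - card (?f ` ?A))"
        using card_monochromatic_pairs_le[OF finite_neighbours[of w], of ?f] by simp
      also have "\<dots> \<le> Suc (n - d - 1) * (n - d - 1)"
        using card_nbrs[OF w] deg[OF w] unfolding color_degree_neighbours
        by (intro mult_le_mono) linarith+
      also have "Suc (n - d - 1) = n - d" using d_le n_pos by simp
      finally show "card {p \<in> P. ?mono p w} \<le> (n - d) * (n - d - 1)" .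
    qed
    finally show ?thesis by (simp add: n_def)
  qed
  have common_le: "card {w \<in> V. ?common p w} \<le> 3 + card {w \<in> V. ?mono p w}"
    if p_P: "p \<in> P" for p
  proof -
    obtain u v where p: "p = (u, v)" "u \<in> V" "v \<in> V" "u \<noteq> v"
      using p_P by (auto simp: P_def)
    let ?M = "{w \<in> V. w \<in> N u \<and> w \<in> N v \<and> c {u, w} \<noteq> c {v, w}}"
    have "card ?M \<le> 3"
    proof (rule card_common_two_colored_le_3[OF no_C4 \<open>u \<noteq> v\<close>])
      show "inj_on (\<lambda>w. c {u, w}) ?M" "inj_on (\<lambda>w. c {v, w}) ?M"
        using N(2) p by (auto intro: inj_on_subset)
    qed (use N(1) p in auto)
    moreover have "{w \<in> V. ?common p w} \<subseteq> ?M \<union> {w \<in> V. ?mono p w}"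
      using N(1) p by auto
    then have "card {w \<in> V. ?common p w} \<le> card ?M + card {w \<in> V. ?mono p w}"
      by (intro order_trans[OF card_mono card_Un_le]) (use finite_V in auto)
    ultimately show ?thesis by linarith
  qed

  have "(\<Sum>w\<in>V. b w * (b w - 1)) \<le> (\<Sum>p\<in>P. 3 + card {w \<in> V. ?mono p w})"
    unfolding common_by_middle[symmetric] by (intro sum_mono common_le)
  also have "\<dots> \<le> 3 * (n * (n - 1)) + n * ((n - d) * (n - d - 1))"
    using mono_by_middle cardP by (simp add: sum.distrib)
  finally have upper: "(\<Sum>w\<in>V. b w * (b w - 1))
    \<le> n * (3 * (n - 1) + (n - d) * (n - d - 1))" by (simp add: algebra_simps)

  \<comment> \<open>Convexity: the average of \<open>b\<close> is \<open>d\<close>, and the parabola \<open>x * (x - 1)\<close> lies above its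
    tangent at \<open>d\<close>.\<close>
  have "int n * (int d * (int d - 1))
      = (\<Sum>w\<in>V. int d * (int d - 1) + (2 * int d - 1) * (int (b w) - int d))"
  proof -
    have "(\<Sum>w\<in>V. int (b w)) = int n * int d" using sum_b by (metis of_nat_mult of_nat_sum)
    then show ?thesis
      by (simp add: sum.distrib sum_distrib_left[symmetric] sum_subtractf n_def)
  qed
  also have "\<dots> \<le> (\<Sum>w\<in>V. int (b w * (b w - 1)))"
  proof (rule sum_mono)
    fix w
    have "0 \<le> (int (b w) - int d)\<^sup>2" by simp
    moreover have "int (b w * (b w - 1)) = int (b w) * (int (b w) - 1)"
      by (cases "b w") (simp_all add: algebra_simps)
    ultimately show "int d * (int d - 1) + (2 * int d - 1) * (int (b w) - int d)
        \<le> int (b w * (b w - 1))"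
      by (simp add: power2_eq_square algebra_simps)
  qed
  also have "\<dots> \<le> int (n * (3 * (n - 1) + (n - d) * (n - d - 1)))"
    using upper by (simp only: of_nat_sum[symmetric] of_nat_le_iff)
  also have "\<dots> = int n * (3 * (int n - 1) + (int n - int d) * (int n - int d - 1))"
    using d_le n_pos by (simp add: of_nat_diff)
  finally have "int d * (int d - 1) \<le> 3 * (int n - 1) + (int n - int d) * (int n - int d - 1)"
    using n_pos by simp
  then have "0 \<le> (int n - 1) * (int n + 3 - 2 * int d)"
    by (simp add: algebra_simps)
  \<comment> \<open>For \<open>n = 1\<close> the inequality carries no information, but then \<open>d = 0\<close>.\<close>
  then have "n = 1 \<or> 2 * d \<le> n + 3"
    using n_pos by (auto simp: zero_le_mult_iff)
  then show ?thesis using d_le by (auto simp: n_def)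
qed

theorem theorem3p6:
  fixes V :: "'a set" and E :: "'a set set" and c :: "'a set \<Rightarrow> nat" and n k :: nat
  assumes "simple_graph V E"
    and "card V = n"
    and "k \<ge> 5"
    and "\<not> (\<exists>C. is_cycle E C \<and> rainbow c C \<and> card C = 4)"
    and "real (min_color_degree V E c) > (real n + 3 * real k - 3) / 2"
  shows "\<exists>C. is_cycle E C \<and> rainbow c C \<and> card C \<ge> k"
proof -
  interpret simple_graph V E by fact
  have "min_color_degree V E c \<le> color_degree E c v" if "v \<in> V" for v
    using that finite_V by (simp add: min_color_degree_def)
  then have "2 * min_color_degree V E c \<le> n + 3"
    using min_color_degree_le_if_no_rainbow_C4[OF assms(4)] assms(2) by blast
  then have "2 * real (min_color_degree V E c) \<le> real n + 3" by linarith
  moreover have "3 * real k \<ge> 15" using assms(3) by simp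
  ultimately have False using assms(5) by argo
  then show ?thesis ..
qed

end
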